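(* Let $D=(V,A)$ be a digraph and $k\ge 2$ an integer. A subset $S\subseteq V$ is $k$-sink-stable if and only if $|S\cap V(C)|\le k\,\eta(C)$ for every circuit $C$ of $D$.
   Context: Digraphs are finite; parallel and oppositely directed edges are allowed. A directed cut (dicut) of a digraph is the set of edges entering a subset $Z$ of nodes, provided no edge leaves $Z$. A sink node is a node with no leaving edge; a sink set is a set of nodes each of which is a sink. A set of nodes is sink-stable in $D$ if there are pairwise edge-disjoint dicuts of $D$ such that, after reversing the orientation of all edges of these dicuts, the set becomes a sink set. A set of nodes is $k$-sink-stable if it can be partitioned into $k$ sink-stable sets (possibly empty). A circuit $C$ of $D$ is a subdigraph whose underlying undirected graph is a circuit (connected with every degree equal to 2; its edges may be oriented arbitrarily, and two edges joining the same two nodes form a circuit); $V(C)$ is its node-set. Traversing $C$ in one of its two directions, each edge is forward or backward according to whether it is traversed along or against its orientation; $\eta(C)$ is the minimum of the number of forward edges and the number of backward edges of $C$ (this does not depend on the direction of traversal). *)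

theory Defs
  imports "Graph_Theory.Graph_Theory" "HOL-Library.Disjoint_Sets"
begin

definition arcs_entering :: "('a,'b) pre_digraph \<Rightarrow> 'a set \<Rightarrow> 'b set" where
  "arcs_entering D Z = {e \<in> arcs D. tail D e \<notin> Z \<and> head D e \<in> Z}"

definition arcs_leaving :: "('a,'b) pre_digraph \<Rightarrow> 'a set \<Rightarrow> 'b set" where
  "arcs_leaving D Z = {e \<in> arcs D. tail D e \<in> Z \<and> head D e \<notin> Z}"

definition dicut :: "('a,'b) pre_digraph \<Rightarrow> 'b set \<Rightarrow> bool" where
  "dicut D B \<longleftrightarrow> (\<exists>Z \<subseteq> verts D. arcs_leaving D Z = {} \<and> B = arcs_entering D Z)"

definition reverse_arcs :: "('a,'b) pre_digraph \<Rightarrow> 'b set \<Rightarrow> ('a,'b) pre_digraph" where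
  "reverse_arcs D F =
     D\<lparr> tail := (\<lambda>e. if e \<in> F then head D e else tail D e),
        head := (\<lambda>e. if e \<in> F then tail D e else head D e) \<rparr>"

(* A loop at v belongs to out_arcs D v, so a node carrying a loop is not a sink. *)
definition sink :: "('a,'b) pre_digraph \<Rightarrow> 'a \<Rightarrow> bool" where
  "sink D v \<longleftrightarrow> v \<in> verts D \<and> out_arcs D v = {}"

definition sink_set :: "('a,'b) pre_digraph \<Rightarrow> 'a set \<Rightarrow> bool" where
  "sink_set D S \<longleftrightarrow> (\<forall>v \<in> S. sink D v)"

(* Taking a set of dicuts rather than a family is no restriction: only the
   empty dicut could be repeated in an edge-disjoint family. *)
definition sink_stable :: "('a,'b) pre_digraph \<Rightarrow> 'a set \<Rightarrow> bool" where
  "sink_stable D S \<longleftrightarrow>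
     (\<exists>\<B>. (\<forall>B \<in> \<B>. dicut D B) \<and> pairwise disjnt \<B> \<and>
          sink_set (reverse_arcs D (\<Union>\<B>)) S)"

definition k_sink_stable :: "('a,'b) pre_digraph \<Rightarrow> nat \<Rightarrow> 'a set \<Rightarrow> bool" where
  "k_sink_stable D k S \<longleftrightarrow>
     (\<exists>P :: nat \<Rightarrow> 'a set. disjoint_family_on P {..<k} \<and> (\<Union>i<k. P i) = S \<and>
          (\<forall>i<k. sink_stable D (P i)))"

(* in_degree + out_degree is the degree in the underlying undirected multigraph;
   a loop contributes 2, hence forms a circuit with one node. *)
definition circuit :: "('a,'b) pre_digraph \<Rightarrow> ('a,'b) pre_digraph \<Rightarrow> bool" where
  "circuit D C \<longleftrightarrow> subgraph C D \<and> connected C \<and>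
     (\<forall>v \<in> verts C. in_degree C v + out_degree C v = 2)"

(* A pair (e, b) is the edge e traversed along (b = True) or against (b = False)
   its orientation. *)
fun step_start :: "('a,'b) pre_digraph \<Rightarrow> 'b \<times> bool \<Rightarrow> 'a" where
  "step_start C (e, b) = (if b then tail C e else head C e)"

fun step_end :: "('a,'b) pre_digraph \<Rightarrow> 'b \<times> bool \<Rightarrow> 'a" where
  "step_end C (e, b) = (if b then head C e else tail C e)"

(* A traversal of a circuit: a closed walk in the underlying undirected graph,
   given cyclically, that uses every edge of C exactly once. *)
definition traversal :: "('a,'b) pre_digraph \<Rightarrow> ('b \<times> bool) list \<Rightarrow> bool" where
  "traversal C w \<longleftrightarrow> distinct (map fst w) \<and> set (map fst w) = arcs C \<and>
     (\<forall>i < length w. step_end C (w ! i) = step_start C (w ! (Suc i mod length w)))"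

definition forward_arcs :: "('b \<times> bool) list \<Rightarrow> 'b set" where
  "forward_arcs w = {e. (e, True) \<in> set w}"

definition backward_arcs :: "('b \<times> bool) list \<Rightarrow> 'b set" where
  "backward_arcs w = {e. (e, False) \<in> set w}"

(* A circuit has traversals in two directions, each up to rotation; changing the
   direction swaps forward and backward edges, so the value does not depend on the
   traversal chosen. *)
definition eta :: "('a,'b) pre_digraph \<Rightarrow> nat" where
  "eta C = (let w = (SOME w. traversal C w)
            in min (card (forward_arcs w)) (card (backward_arcs w)))"

end

theory Submission
  imports Defs
begin

text \<open>
  Both directions pass through integer potentials. Adding up the indicator functions of the sets
  behind pairwise disjoint dicuts gives a function \<open>\<pi>\<close> that grows by 0 or 1 along each edge, by 1
  exactly on the edges to be reversed; conversely, the upper level sets of such a \<open>\<pi>\<close> define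
  disjoint dicuts. Hence \<open>S\<close> is sink-stable iff some \<open>\<pi>\<close> with increments in \<open>{0, 1}\<close> grows by 1
  along every edge leaving a node of \<open>S\<close> and by 0 along every edge entering one
  (\<open>sink_stable_iff_potential\<close>).

  Necessity: along a traversal of a circuit the signed increments of \<open>\<pi>\<close> cancel. Comparing, step by
  step, the presence of \<open>S\<close> at the end (or start) of the step with the direction of the step and
  the increment of \<open>\<pi>\<close> bounds \<open>|S \<inter> V(C)|\<close> by the number of forward (or backward) edges, for each
  sink-stable \<open>S\<close> (\<open>sink_stable_card_le_eta\<close>). Summing over the \<open>k\<close> classes of a partition gives the
  factor \<open>k\<close>.

  Sufficiency: one looks for a single potential \<open>\<pi>\<close> whose increment on an edge \<open>uv\<close> lies between
  \<open>[u \<in> S]\<close> and \<open>k - [v \<in> S]\<close>, a bracket being 1 if the condition in it holds and 0 otherwise.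
  From it the class of \<open>s \<in> S\<close> is read off as \<open>\<pi>(s) mod k\<close>,
  and the potential showing that a class is sink-stable is a shift of \<open>\<pi>\<close> divided by \<open>k\<close> and
  rounded down, the shift being such that the rounded value jumps right above the nodes of the class.
  By Gallai's theorem (\<open>potential_exists\<close>), \<open>\<pi>\<close> exists unless
  some simple closed walk has negative cost, where a forward step costs \<open>k\<close>, a backward step
  costs 0, and a step ending in \<open>S\<close> costs 1 less. A simple closed walk either traverses a circuit
  \<open>C\<close>, and then its cost is \<open>k\<close> times the number of forward edges minus \<open>|S \<inter> V(C)|\<close>, which the
  hypothesis makes nonnegative; or it goes along one edge and straight back, at a cost of at least
  \<open>k - 2\<close>. The latter walk is the reason for requiring \<open>k \<ge> 2\<close>.

  What remains is to connect circuits, given by degrees and connectedness, with closed walks: every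
  circuit has a traversal, any two have the same edges forward up to a global reversal, and a simple
  closed walk without repeated edges spans a circuit.
\<close>

section \<open>Walks in the underlying undirected graph\<close>

text \<open>
  The sequence of nodes visited by \<open>w\<close> can be read off from the ends of its steps or from their
  starts; the equation says that the two readings agree.
\<close>

definition walk :: "('a,'b) pre_digraph \<Rightarrow> 'a \<Rightarrow> ('b \<times> bool) list \<Rightarrow> 'a \<Rightarrow> bool" where
  "walk D u w v \<longleftrightarrow> u # map (step_end D) w = map (step_start D) w @ [v]"

definition closed_steps :: "('a,'b) pre_digraph \<Rightarrow> ('b \<times> bool) list \<Rightarrow> bool" where
  "closed_steps D w \<longleftrightarrow> map (step_end D) w = rotate1 (map (step_start D) w)"

lemma walk_Nil [simp]: "walk D u [] v \<longleftrightarrow> u = v"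
  by (simp add: walk_def)

lemma walk_Cons [simp]:
  "walk D u (x # w) v \<longleftrightarrow> step_start D x = u \<and> walk D (step_end D x) w v"
  by (auto simp: walk_def)

lemma walk_append: "walk D u (p @ q) v \<longleftrightarrow> (\<exists>t. walk D u p t \<and> walk D t q v)"
  by (induction p arbitrary: u) auto

lemma walk_closed_iff:
  "w \<noteq> [] \<Longrightarrow> (\<exists>u. walk D u w u) \<longleftrightarrow> closed_steps D w"
  by (cases w) (auto simp: walk_def closed_steps_def)

lemma walk_ends_mset:
  "walk D u w v \<Longrightarrow>
   add_mset u (mset (map (step_end D) w)) = add_mset v (mset (map (step_start D) w))"
  unfolding walk_def by (metis mset.simps(2) mset_append add_mset_add_single mset.simps(1))

lemma closed_steps_mset:
  "closed_steps D w \<Longrightarrow> mset (map (step_end D) w) = mset (map (step_start D) w)"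
  unfolding closed_steps_def by (cases w) simp_all

lemma closed_steps_nth:
  "closed_steps D w \<longleftrightarrow>
   (\<forall>i<length w. step_end D (w ! i) = step_start D (w ! (Suc i mod length w)))"
proof -
  have "Suc i mod length w < length w" if "i < length w" for i
    using that by (intro mod_less_divisor) linarith
  then show ?thesis
    unfolding closed_steps_def list_eq_iff_nth_eq by (auto simp: nth_rotate1)
qed

lemma traversal_iff:
  "traversal C w \<longleftrightarrow> distinct (map fst w) \<and> fst ` set w = arcs C \<and> closed_steps C w"
  by (simp add: traversal_def closed_steps_nth)

text \<open>
  Properties passed on from each step of a closed walk to the next one hold for all steps as soon as
  they hold for one. This is the form in which the connectedness of a circuit is used.
\<close>

lemma cyclic_induct:
  assumes "i < n" "P i" and step: "\<And>i. i < n \<Longrightarrow> P i \<Longrightarrow> P (Suc i mod n)" and "j < n"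
  shows "P j"
proof -
  have "P ((i + m) mod n)" for m
  proof (induction m)
    case 0
    then show ?case using assms by simp
  next
    case (Suc m)
    have "(i + m) mod n < n" using \<open>i < n\<close> by simp
    from step[OF this Suc] show ?case by (simp add: mod_Suc_eq)
  qed
  from this[of "j + n - i"] show ?thesis using \<open>i < n\<close> \<open>j < n\<close> by simp
qed

lemma closed_steps_induct:
  assumes "closed_steps D w" "x \<in> set w" "P x"
    and step: "\<And>x y. \<lbrakk>x \<in> set w; y \<in> set w; P x; step_end D x = step_start D y\<rbrakk> \<Longrightarrow> P y"
    and "y \<in> set w"
  shows "P y"
proof -
  obtain i where i: "i < length w" "w ! i = x" using assms(2) by (auto simp: in_set_conv_nth)
  obtain j where j: "j < length w" "w ! j = y" using assms(5) by (auto simp: in_set_conv_nth)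
  have "P (w ! (Suc l mod length w))" if l: "l < length w" "P (w ! l)" for l
  proof -
    have m: "Suc l mod length w < length w" using l by (intro mod_less_divisor) linarith
    have "step_end D (w ! l) = step_start D (w ! (Suc l mod length w))"
      using assms(1) l unfolding closed_steps_nth by blast
    then show ?thesis by (rule step[OF nth_mem[OF l(1)] nth_mem[OF m] l(2)])
  qed
  from cyclic_induct[where P = "\<lambda>l. P (w ! l)", OF i(1) _ this j(1)] show ?thesis
    unfolding i(2) j(2) using \<open>P x\<close> by blast
qed

section \<open>Connectedness and degrees\<close>

text \<open>
  Connectedness is defined by reachability in a symmetrized digraph. This cut form serves
  both to derive and to prove connectedness without handling undirected paths.
\<close>

lemma connected_iff_no_closed_part:
  assumes "wf_digraph C"
  shows "connected C \<longleftrightarrow> verts C \<noteq> {} \<and>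
    (\<forall>Z. Z \<subseteq> verts C \<longrightarrow> Z \<noteq> {} \<longrightarrow> (\<forall>e\<in>arcs C. tail C e \<in> Z \<longleftrightarrow> head C e \<in> Z) \<longrightarrow> Z = verts C)"
    (is "_ \<longleftrightarrow> _ \<and> ?R")
proof -
  interpret wf_digraph C by fact
  interpret M: pair_wf_digraph "mk_symmetric C" ..
  have R: "?R" if sc: "strongly_connected (mk_symmetric C)"
  proof (intro allI impI subset_antisym subsetI)
    fix Z v assume Z: "Z \<subseteq> verts C" "Z \<noteq> {}" "\<forall>e\<in>arcs C. tail C e \<in> Z \<longleftrightarrow> head C e \<in> Z"
      and v: "v \<in> verts C"
    obtain u where u: "u \<in> Z" using Z by auto
    have "u \<rightarrow>\<^sup>*\<^bsub>mk_symmetric C\<^esub> v"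
      using sc u v Z(1) by (auto simp: strongly_connected_def)
    then show "v \<in> Z"
    proof (induction rule: M.reachable_induct)
      case base
      then show ?case using u by simp
    next
      case (step x y)
      then show ?case using Z(3) by (auto simp: parcs_mk_symmetric)
    qed
  qed auto
  have sc: "strongly_connected (mk_symmetric C)" if ne: "verts C \<noteq> {}" and R: ?R
  proof -
    have "u \<rightarrow>\<^sup>*\<^bsub>mk_symmetric C\<^esub> v" if u: "u \<in> verts C" and v: "v \<in> verts C" for u v
    proof -
      let ?Z = "{v \<in> verts C. u \<rightarrow>\<^sup>*\<^bsub>mk_symmetric C\<^esub> v}"
      have "u \<in> ?Z" using u by (auto intro!: M.reachable_refl)
      moreover have "tail C e \<in> ?Z \<longleftrightarrow> head C e \<in> ?Z" if "e \<in> arcs C" for e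
      proof -
        have "(tail C e, head C e) \<in> parcs (mk_symmetric C)" "(head C e, tail C e) \<in> parcs (mk_symmetric C)"
          using that by (auto simp: parcs_mk_symmetric)
        then have "u \<rightarrow>\<^sup>*\<^bsub>mk_symmetric C\<^esub> tail C e \<longleftrightarrow> u \<rightarrow>\<^sup>*\<^bsub>mk_symmetric C\<^esub> head C e"
          using M.reachable_adj_trans[of u "tail C e" "head C e"]
            M.reachable_adj_trans[of u "head C e" "tail C e"] by auto
        then show ?thesis using that by simp
      qed
      ultimately have "?Z = verts C" using R[THEN spec, of ?Z] by (metis (no_types, lifting) empty_iff mem_Collect_eq subsetI)
      with v show ?thesis by blast
    qed
    with ne show ?thesis by (auto simp: strongly_connected_def)
  qed
  have ne: "verts C \<noteq> {}" if "strongly_connected (mk_symmetric C)"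
    using that by (simp add: strongly_connected_def)
  show ?thesis
    unfolding connected_def by (rule iffI, rule conjI, erule ne, erule R, erule conjE, erule (1) sc)
qed

text \<open>A loop has incidence 2 with its node, as in the degree.\<close>

definition incidence :: "('a,'b) pre_digraph \<Rightarrow> 'a \<Rightarrow> 'b \<Rightarrow> nat" where
  "incidence C v e = of_bool (tail C e = v) + of_bool (head C e = v)"

lemma degree_sum_incidence:
  assumes "finite (arcs C)"
  shows "in_degree C v + out_degree C v = (\<Sum>e\<in>arcs C. incidence C v e)"
  using assms
  by (simp add: incidence_def sum.distrib in_degree_def out_degree_def in_arcs_def out_arcs_def
      Int_def of_bool_def sum.If_cases)

lemma step_counts_sum_incidence:
  assumes "distinct (map fst w)"
  shows "count (mset (map (step_start C) w)) v + count (mset (map (step_end C) w)) v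
    = (\<Sum>e\<in>fst ` set w. incidence C v e)"
  using assms
proof (induction w)
  case (Cons x w)
  then show ?case by (cases x) (auto simp: incidence_def)
qed simp

section \<open>Traversals of circuits\<close>

lemma circuitD:
  assumes "fin_digraph D" "circuit D C"
  shows "wf_digraph C" "finite (arcs C)" "arcs C \<subseteq> arcs D"
    "tail C = tail D" "head C = head D" "connected C"
    "\<And>v. v \<in> verts C \<Longrightarrow> in_degree C v + out_degree C v = 2"
  using assms finite_subset[of "arcs C" "arcs D"]
  by (auto simp: circuit_def subgraph_def compatible_def fin_digraph_def fin_digraph_axioms_def)

lemma step_cong: "tail C = tail D \<Longrightarrow> head C = head D \<Longrightarrow> step_start C = step_start D"
  "tail C = tail D \<Longrightarrow> head C = head D \<Longrightarrow> step_end C = step_end D"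
  by (auto simp: fun_eq_iff)

lemma steps_in_verts:
  assumes "wf_digraph C" "fst x \<in> arcs C"
  shows "step_start C x \<in> verts C" "step_end C x \<in> verts C"
  using assms by (cases x; simp add: wf_digraph.tail_in_verts wf_digraph.head_in_verts)+

lemma incident_step:
  assumes "incidence C v e > 0"
  obtains b where "step_start C (e, b) = v"
  using assms that[of True] that[of False] by (auto simp: incidence_def of_bool_def split: if_splits)

text \<open>
  A longest trail is a traversal. If its two ends differed, an odd number of the two edge-ends at its
  last node would be used, and the trail could be extended. So it is closed, and it uses both
  edge-ends at each node that it visits; hence no edge joins visited and unvisited nodes, and
  connectedness shows that every node, and therefore every edge, is covered.
\<close>

lemma circuit_has_traversal:
  assumes D: "fin_digraph D" and C: "circuit D C"
  shows "\<exists>w. traversal C w"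
proof -
  note c = circuitD[OF D C]
  define trail where "trail w \<longleftrightarrow> distinct (map fst w) \<and> fst ` set w \<subseteq> arcs C \<and> w \<noteq> [] \<and> (\<exists>u v. walk C u w v)" for w
  have deg: "(\<Sum>e\<in>arcs C. incidence C v e) = 2" if "v \<in> verts C" for v
    using c(7)[OF that] degree_sum_incidence[OF c(2)] by simp
  obtain v0 where v0: "v0 \<in> verts C"
    using c(6) connected_iff_no_closed_part[OF c(1)] by auto
  then obtain e0 where e0: "e0 \<in> arcs C"
    using deg[OF v0] by (cases "arcs C = {}") auto
  have "trail [(e0, True)]" using e0 by (auto simp: trail_def)
  moreover have "\<forall>w. trail w \<longrightarrow> length w < Suc (card (arcs C))"
  proof (intro allI impI)
    fix w assume "trail w"
    then have "distinct (map fst w)" "set (map fst w) \<subseteq> arcs C" by (auto simp: trail_def)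
    then show "length w < Suc (card (arcs C))"
      using card_mono[OF c(2), of "set (map fst w)"] distinct_card[of "map fst w"] by simp
  qed
  ultimately have "\<exists>w. trail w \<and> (\<forall>w'. trail w' \<longrightarrow> length w' \<le> length w)"
    by (rule ex_has_greatest_nat)
  then obtain w where w: "trail w" and max: "\<And>w'. trail w' \<Longrightarrow> length w' \<le> length w"
    by blast
  then obtain u v where walk: "walk C u w v" by (auto simp: trail_def)
  have dw: "distinct (map fst w)" and sw: "fst ` set w \<subseteq> arcs C" and ne: "w \<noteq> []"
    using w by (auto simp: trail_def)
  define used where "used z = count (mset (map (step_start C) w)) z + count (mset (map (step_end C) w)) z" for z
  have used: "used z = (\<Sum>e\<in>fst ` set w. incidence C z e)" for z
    unfolding used_def by (rule step_counts_sum_incidence[OF dw])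
  have split: "used z + (\<Sum>e\<in>arcs C - fst ` set w. incidence C z e) = 2" if "z \<in> verts C" for z
    using deg[OF that] sum.subset_diff[OF sw c(2), of "incidence C z"] used by simp
  have v: "v \<in> verts C"
  proof -
    have "v \<in># add_mset u (mset (map (step_end C) w))"
      unfolding walk_ends_mset[OF walk] by simp
    moreover have "u \<in> step_start C ` set w"
      using ne walk by (cases w) auto
    ultimately obtain x where "x \<in> set w" "v = step_start C x \<or> v = step_end C x"
      by auto
    then show ?thesis using steps_in_verts[OF c(1), of x] sw by auto
  qed
  have uv: "u = v"
  proof (rule ccontr)
    assume "u \<noteq> v"
    have "count (add_mset u (mset (map (step_end C) w))) v = count (add_mset v (mset (map (step_start C) w))) v"
      using walk_ends_mset[OF walk] by simp
    then have "used v = 2 * count (mset (map (step_start C) w)) v + 1"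
      using \<open>u \<noteq> v\<close> by (simp add: used_def)
    with split[OF v] have "(\<Sum>e\<in>arcs C - fst ` set w. incidence C v e) \<noteq> 0"
      by presburger
    then obtain e where e: "e \<in> arcs C - fst ` set w" "incidence C v e > 0"
      by (metis sum.neutral neq0_conv)
    then obtain b where b: "step_start C (e, b) = v" using incident_step by metis
    have "walk C u (w @ [(e, b)]) (step_end C (e, b))"
      using walk b by (auto simp: walk_append simp del: step_end.simps step_start.simps)
    then have "trail (w @ [(e, b)])"
      using dw sw e unfolding trail_def by auto
    from max[OF this] show False by simp
  qed
  then have cl: "closed_steps C w" using walk walk_closed_iff[OF ne] by metis
  let ?Z = "step_end C ` set w"
  have full: "incidence C z e = 0" if z: "z \<in> ?Z" and e: "e \<in> arcs C - fst ` set w" for z e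
  proof -
    have zv: "z \<in> verts C" using z sw by (auto intro!: steps_in_verts[OF c(1)])
    have "count (mset (map (step_end C) w)) z > 0" using z by (auto simp: count_greater_zero_iff)
    then have "used z \<ge> 2" unfolding used_def closed_steps_mset[OF cl] by linarith
    with split[OF zv] have "(\<Sum>e\<in>arcs C - fst ` set w. incidence C z e) = 0" by simp
    then show ?thesis using e c(2) by (simp add: sum_nonneg_eq_0_iff)
  qed
  have starts: "step_start C ` set w = ?Z"
    using arg_cong[OF closed_steps_mset[OF cl], of set_mset] by simp
  have used_in: "tail C e \<in> ?Z" "head C e \<in> ?Z" if "e \<in> fst ` set w" for e
  proof -
    obtain b where "(e, b) \<in> set w" using \<open>e \<in> fst ` set w\<close> by auto
    then have "step_start C (e, b) \<in> ?Z" "step_end C (e, b) \<in> ?Z" using starts by blast+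
    then show "tail C e \<in> ?Z" "head C e \<in> ?Z" by (cases b; simp)+
  qed
  have "tail C e \<in> ?Z \<longleftrightarrow> head C e \<in> ?Z" if "e \<in> arcs C" for e
  proof (cases "e \<in> fst ` set w")
    case False
    then have "tail C e \<notin> ?Z" "head C e \<notin> ?Z"
      using full[of "tail C e" e] full[of "head C e" e] that by (auto simp: incidence_def)
    then show ?thesis by simp
  qed (use used_in in simp)
  moreover have "?Z \<subseteq> verts C" using sw by (auto intro!: steps_in_verts[OF c(1)])
  moreover have "?Z \<noteq> {}" using ne by simp
  ultimately have Z: "?Z = verts C"
    using c(6)[unfolded connected_iff_no_closed_part[OF c(1)], THEN conjunct2, rule_format, of ?Z]
    by simp
  have "e \<in> fst ` set w" if "e \<in> arcs C" for e
  proof (rule ccontr)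
    assume "e \<notin> fst ` set w"
    then have "incidence C (head C e) e = 0"
      using full Z that wf_digraph.head_in_verts[OF c(1)] by blast
    then show False by (simp add: incidence_def)
  qed
  then have "traversal C w" using dw sw cl by (auto simp: traversal_iff)
  then show ?thesis ..
qed

text \<open>
  A closed walk enters a node as often as it leaves it; in a traversal these numbers add up to the
  degree 2.
\<close>

lemma traversal_visits_once:
  assumes D: "fin_digraph D" and C: "circuit D C" and w: "traversal C w"
  shows "distinct (map (step_end C) w)" "step_end C ` set w = verts C"
    "distinct (map (step_start C) w)" "step_start C ` set w = verts C"
proof -
  note c = circuitD[OF D C]
  have dw: "distinct (map fst w)" and sw: "fst ` set w = arcs C" and cl: "closed_steps C w"
    using w by (auto simp: traversal_iff)
  note ms = closed_steps_mset[OF cl]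
  have "2 * count (mset (map (step_end C) w)) z = 2" if "z \<in> verts C" for z
    using step_counts_sum_incidence[OF dw, of C z] c(7)[OF that] degree_sum_incidence[OF c(2), of z]
      sw ms by simp
  then have one: "count (mset (map (step_end C) w)) z = 1" if "z \<in> verts C" for z
    using that by fastforce
  have sub: "step_end C ` set w \<subseteq> verts C" using sw by (auto intro!: steps_in_verts[OF c(1)])
  have "verts C \<subseteq> step_end C ` set w"
  proof
    fix z assume "z \<in> verts C"
    then show "z \<in> step_end C ` set w"
      using one[of z] count_eq_zero_iff[of "mset (map (step_end C) w)" z] by auto
  qed
  with sub show Z: "step_end C ` set w = verts C" by blast
  show d: "distinct (map (step_end C) w)"
    unfolding distinct_count_atmost_1
  proof
    fix a
    show "count (mset (map (step_end C) w)) a = (if a \<in> set (map (step_end C) w) then 1 else 0)"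
      using one[of a] Z count_mset_0_iff[of "map (step_end C) w" a] by (cases "a \<in> verts C") auto
  qed
  show "distinct (map (step_start C) w)" using d mset_eq_imp_distinct_iff[OF ms] by blast
  show "step_start C ` set w = verts C" using Z arg_cong[OF ms, of set_mset] by simp
qed

definition flip :: "'b \<times> bool \<Rightarrow> 'b \<times> bool" where
  "flip x = (fst x, \<not> snd x)"

lemma flip_simps [simp]: "fst (flip x) = fst x" "flip (flip x) = x" "flip x \<noteq> x"
  "step_start C (flip x) = step_end C x" "step_end C (flip x) = step_start C x"
  by (cases x; auto simp: flip_def)+

lemma same_fst: "fst x = fst y \<Longrightarrow> x = y \<or> x = flip y"
  by (cases x; cases y) (auto simp: flip_def)

lemma distinct_fst_inj: "\<lbrakk>distinct (map fst w); x \<in> set w; y \<in> set w; fst x = fst y\<rbrakk> \<Longrightarrow> x = y"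
  by (meson distinct_map inj_onD)

text \<open>
  If two traversals use an edge in the same direction, then they also agree on the edge that comes next in
  the first one: otherwise the second one would enter the node between these edges twice. Going round the
  circuit, they agree everywhere or nowhere.
\<close>

lemma traversal_unique_up_to_flip:
  assumes D: "fin_digraph D" and C: "circuit D C" and w: "traversal C w" and w': "traversal C w'"
  shows "set w' = set w \<or> set w' = flip ` set w"
proof -
  have dw: "distinct (map fst w)" and sw: "fst ` set w = arcs C" and cl: "closed_steps C w"
    using w by (auto simp: traversal_iff)
  have dw': "distinct (map fst w')" and sw': "fst ` set w' = arcs C"
    using w' by (auto simp: traversal_iff)
  have alt: "x \<in> set w' \<or> flip x \<in> set w'" if x: "x \<in> set w" for x
  proof -
    have "fst x \<in> fst ` set w'" using x sw sw' by auto
    then obtain x' where x': "fst x = fst x'" "x' \<in> set w'" by (rule imageE)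
    then show ?thesis using same_fst[of x' x] by auto
  qed
  have covered: "x \<in> set w \<or> flip x \<in> set w" if x: "x \<in> set w'" for x
  proof -
    have "fst x \<in> fst ` set w" using x sw sw' by auto
    then obtain x' where x': "fst x = fst x'" "x' \<in> set w" by (rule imageE)
    then show ?thesis using same_fst[of x' x] by auto
  qed
  have nflip: "\<not> (x \<in> set v \<and> flip x \<in> set v)" if "distinct (map fst v)" for x v
    using distinct_fst_inj[OF that, of x "flip x"] by (metis flip_simps(1,3))
  have step: "y \<in> set w'"
    if "x \<in> set w" "y \<in> set w" "x \<in> set w'" "step_end C x = step_start C y" for x y
  proof (rule ccontr)
    assume "y \<notin> set w'"
    then have fy: "flip y \<in> set w'" using alt that by blast
    have "flip y = x"
      using traversal_visits_once(1)[OF D C w'] that fy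
      by (metis distinct_map inj_onD flip_simps(5))
    with that nflip[OF dw, of y] show False by blast
  qed
  show ?thesis
  proof (cases "\<exists>x \<in> set w. x \<in> set w'")
    case True
    then obtain x where "x \<in> set w" "x \<in> set w'" by blast
    then have all: "y \<in> set w'" if "y \<in> set w" for y
      using closed_steps_induct[OF cl, of x "\<lambda>x. x \<in> set w'" y] step that by blast
    have "y \<in> set w" if "y \<in> set w'" for y
      using covered[OF that] all nflip[OF dw', of y] that by blast
    with all show ?thesis by blast
  next
    case False
    have "flip y \<in> set w'" if "y \<in> set w" for y using alt False that by blast
    moreover have "y \<in> flip ` set w" if "y \<in> set w'" for y
      using covered[OF that] False that by (metis flip_simps(2) image_eqI)
    ultimately show ?thesis by blast
  qed
qed

text \<open>
  The choice operator in \<open>eta\<close> may pick any traversal; by the previous lemma it can at most swap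
  forward and backward edges.
\<close>

lemma eta_eq:
  assumes D: "fin_digraph D" and C: "circuit D C" and w: "traversal C w"
  shows "eta C = min (card (forward_arcs w)) (card (backward_arcs w))"
proof -
  obtain w' where w': "w' = (SOME w. traversal C w)" by blast
  have eta: "eta C = min (card (forward_arcs w')) (card (backward_arcs w'))"
    unfolding eta_def w' Let_def ..
  have "traversal C w'" unfolding w' using w by (rule someI)
  from traversal_unique_up_to_flip[OF D C w this]
  show ?thesis
  proof
    assume "set w' = set w"
    then show ?thesis by (simp add: eta forward_arcs_def backward_arcs_def)
  next
    assume eq: "set w' = flip ` set w"
    have "(e, b) \<in> set w' \<longleftrightarrow> (e, \<not> b) \<in> set w" for e b
      unfolding eq flip_def image_iff by (auto intro: bexI[of _ "(e, \<not> b)"])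
    then have "forward_arcs w' = backward_arcs w" "backward_arcs w' = forward_arcs w"
      by (simp_all add: forward_arcs_def backward_arcs_def)
    then show ?thesis by (simp add: eta min.commute)
  qed
qed

section \<open>Circuits from simple closed walks\<close>

definition walk_graph :: "('a,'b) pre_digraph \<Rightarrow> ('b \<times> bool) list \<Rightarrow> ('a,'b) pre_digraph" where
  "walk_graph D w = \<lparr>verts = step_end D ` set w, arcs = fst ` set w, tail = tail D, head = head D\<rparr>"

lemma circuit_walk_graph:
  assumes D: "wf_digraph D" and cl: "closed_steps D w" and ne: "w \<noteq> []"
    and arcs: "distinct (map fst w)" "fst ` set w \<subseteq> arcs D"
    and dist: "distinct (map (step_end D) w)"
  shows "circuit D (walk_graph D w)" "traversal (walk_graph D w) w"
proof -
  let ?C = "walk_graph D w"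
  have [simp]: "verts ?C = step_end D ` set w" "Digraph.arcs ?C = fst ` set w"
    "tail ?C = tail D" "head ?C = head D"
    by (simp_all add: walk_graph_def)
  have [simp]: "step_start ?C = step_start D" "step_end ?C = step_end D"
    by (rule step_cong; simp)+
  note ms = closed_steps_mset[OF cl]
  have starts: "step_start D ` set w = step_end D ` set w"
    using arg_cong[OF ms, of set_mset] by simp
  have ends_in: "tail D e \<in> step_end D ` set w \<and> head D e \<in> step_end D ` set w"
    if "e \<in> fst ` set w" for e
  proof -
    obtain b where x: "(e, b) \<in> set w" using \<open>e \<in> fst ` set w\<close> by auto
    have "step_start D (e, b) \<in> step_end D ` set w" "step_end D (e, b) \<in> step_end D ` set w"
      using x starts by blast+
    then show ?thesis by (cases b) simp_all
  qed
  have wf: "wf_digraph ?C"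
    unfolding wf_digraph_def using ends_in by simp
  have "step_end D x \<in> verts D" if "x \<in> set w" for x
    using that arcs(2) by (intro steps_in_verts(2)[OF D]) blast
  then have sub: "subgraph ?C D"
    using arcs(2) D wf by (auto simp: subgraph_def compatible_def)
  show tr: "traversal ?C w"
    using arcs(1) cl by (simp add: traversal_iff closed_steps_def)
  have "connected ?C"
    unfolding connected_iff_no_closed_part[OF wf]
  proof (intro conjI allI impI)
    show "verts ?C \<noteq> {}" using ne by simp
    fix Z assume Z: "Z \<subseteq> verts ?C" "Z \<noteq> {}"
      and closed: "\<forall>e\<in>Digraph.arcs ?C. (tail ?C e \<in> Z) = (head ?C e \<in> Z)"
    then obtain x where x: "x \<in> set w" "step_end D x \<in> Z" by fastforce
    have "step_end D y \<in> Z" if "y \<in> set w" for y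
    proof (rule closed_steps_induct[OF cl x(1), of "\<lambda>x. step_end D x \<in> Z"])
      fix x y assume y: "y \<in> set w" and xy: "step_end D x \<in> Z" "step_end D x = step_start D y"
      have "tail D (fst y) \<in> Z \<longleftrightarrow> head D (fst y) \<in> Z" using closed y by simp
      then show "step_end D y \<in> Z" using xy by (cases y) (simp split: if_splits)
    qed fact+
    then show "Z = verts ?C" using Z(1) by auto
  qed
  moreover have "in_degree ?C v + out_degree ?C v = 2" if v: "v \<in> verts ?C" for v
  proof -
    have "count (mset (map (step_end D) w)) v = 1"
      using dist[unfolded distinct_count_atmost_1, rule_format, of v] v by simp
    then show ?thesis
      using step_counts_sum_incidence[OF arcs(1), of ?C v] degree_sum_incidence[of ?C v] ms by simp
  qed
  ultimately show "circuit D ?C" using sub by (simp add: circuit_def)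
qed

text \<open>
  If an edge occurs twice, then in opposite directions, since the ends of the steps are distinct. As
  the starts are distinct too, each of the two steps is the one that follows the other, so there are
  no further steps.
\<close>

lemma simple_closed_walk_repeats_arc:
  assumes cl: "closed_steps D w" and dist: "distinct (map (step_end D) w)"
    and rep: "\<not> distinct (map fst w)"
  obtains x where "w = [x, flip x]"
proof -
  have dw: "distinct w" using dist by (simp add: distinct_map)
  have ds: "distinct (map (step_start D) w)"
    using dist mset_eq_imp_distinct_iff[OF closed_steps_mset[OF cl]] by blast
  obtain i j where ij: "i < length w" "j < length w" "i \<noteq> j" "fst (w ! i) = fst (w ! j)"
    using rep by (auto simp: distinct_conv_nth)
  then have "w ! i \<noteq> w ! j" using dw by (simp add: nth_eq_iff_index_eq)
  then have flip: "w ! i = flip (w ! j)" using same_fst[OF ij(4)] by blast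
  have succ: "Suc l mod length w = m"
    if l: "l < length w" and m: "m < length w" and f: "w ! l = flip (w ! m)" for l m
  proof -
    have s: "Suc l mod length w < length w" using l by (intro mod_less_divisor) linarith
    have "step_start D (w ! (Suc l mod length w)) = step_end D (w ! l)"
      using cl l unfolding closed_steps_nth by simp
    then have "step_start D (w ! (Suc l mod length w)) = step_start D (w ! m)"
      unfolding f by simp
    then show ?thesis
      using nth_eq_iff_index_eq[OF ds, of "Suc l mod length w" m] s m by simp
  qed
  have flip': "w ! j = flip (w ! i)" unfolding flip by simp
  have i: "Suc i = length w \<and> j = 0 \<or> j = Suc i"
    using succ[OF ij(1,2) flip] ij(1) by (cases "Suc i = length w") auto
  have j: "Suc j = length w \<and> i = 0 \<or> i = Suc j"
    using succ[OF ij(2,1) flip'] ij(2) by (cases "Suc j = length w") auto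
  have len: "length w = 2" and cases: "i = 0 \<and> j = 1 \<or> i = 1 \<and> j = 0"
    using i j ij(3) by linarith+
  from cases have w1: "w ! 1 = flip (w ! 0)"
  proof
    assume "i = 0 \<and> j = 1"
    with flip' show ?thesis by (simp only:)
  next
    assume "i = 1 \<and> j = 0"
    with flip show ?thesis by (simp only:)
  qed
  obtain x y where w: "w = [x, y]"
    using len by (auto simp: numeral_2_eq_2 length_Suc_conv)
  from w1 have "w = [x, flip x]" unfolding w by simp
  then show ?thesis by (rule that)
qed

section \<open>Feasible potentials\<close>

text \<open>
  Gallai's theorem: the potential of \<open>v\<close> is the least cost of a simple walk that ends in \<open>v\<close>, with
  an arbitrary start. If the step \<open>x\<close> leads from the end of an optimal walk back to a node of that walk,
  then the part after this node closes up with \<open>x\<close> to a simple closed walk, whose cost is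
  nonnegative, and the part before it is a competitor for the end of \<open>x\<close>.
\<close>

lemma potential_exists:
  fixes D :: "('a,'b) pre_digraph" and c :: "'b \<times> bool \<Rightarrow> int"
  assumes fin: "finite X"
    and cyc: "\<And>p. \<lbrakk>closed_steps D p; p \<noteq> []; distinct (map (step_end D) p); set p \<subseteq> X\<rbrakk>
      \<Longrightarrow> 0 \<le> sum_list (map c p)"
  obtains \<pi> :: "'a \<Rightarrow> int" where "\<And>x. x \<in> X \<Longrightarrow> \<pi> (step_end D x) \<le> \<pi> (step_start D x) + c x"
proof -
  define Q where "Q v = {p. set p \<subseteq> X \<and> (\<exists>u. walk D u p v \<and> distinct (u # map (step_end D) p))}" for v
  define cost where "cost p = sum_list (map c p)" for p
  define \<pi> where "\<pi> v = Min (cost ` Q v)" for v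
  have finQ: "finite (cost ` Q v)" for v
  proof (rule finite_imageI, rule finite_subset)
    show "Q v \<subseteq> {p. set p \<subseteq> X \<and> length p \<le> card X}"
    proof
      fix p assume "p \<in> Q v"
      then have "set p \<subseteq> X" "distinct p" by (auto simp: Q_def distinct_map)
      then show "p \<in> {p. set p \<subseteq> X \<and> length p \<le> card X}"
        using card_mono[OF fin, of "set p"] distinct_card[of p] by simp
    qed
  qed (rule finite_lists_length_le[OF fin])
  have le: "\<pi> v \<le> cost p" if "p \<in> Q v" for v p
    unfolding \<pi>_def using finQ that by simp
  have attained: "\<exists>p\<in>Q v. \<pi> v = cost p" for v
  proof -
    have "[] \<in> Q v" by (simp add: Q_def)
    then have "\<pi> v \<in> cost ` Q v" unfolding \<pi>_def by (intro Min_in finQ) auto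
    then show ?thesis by auto
  qed
  have "\<pi> (step_end D x) \<le> \<pi> (step_start D x) + c x" if x: "x \<in> X" for x
  proof -
    obtain p where p: "p \<in> Q (step_start D x)" "\<pi> (step_start D x) = cost p"
      using attained by blast
    obtain u where u: "walk D u p (step_start D x)" "distinct (u # map (step_end D) p)" "set p \<subseteq> X"
      using p(1) by (auto simp: Q_def)
    show ?thesis
    proof (cases "step_end D x \<in> set (u # map (step_end D) p)")
      case False
      have "p @ [x] \<in> Q (step_end D x)"
        unfolding Q_def using u x False by (auto simp: walk_append)
      from le[OF this] show ?thesis using p by (simp add: cost_def)
    next
      case True
      \<comment> \<open>Cut the walk at the node where \<open>x\<close> ends; this node may be the start of the walk.\<close>
      obtain p1 p2 where split: "p = p1 @ p2" "walk D u p1 (step_end D x)"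
        "walk D (step_end D x) p2 (step_start D x)"
      proof (cases "step_end D x = u")
        case True
        then show ?thesis using that[of "[]" p] u(1) by simp
      next
        case False
        then obtain y where y: "y \<in> set p" "step_end D y = step_end D x" using True by auto
        then obtain p1 p2 where "p = (p1 @ [y]) @ p2" by (metis append_Cons append_Nil append_assoc split_list)
        then show ?thesis using that[of "p1 @ [y]" p2] u(1) y(2) by (auto simp: walk_append)
      qed
      have notin: "step_end D x \<notin> step_end D ` set p2"
      proof (cases p1 rule: rev_cases)
        case Nil
        then show ?thesis using split u(2) by auto
      next
        case (snoc q y)
        then have "step_end D y = step_end D x" using split(2) by (auto simp: walk_append)
        then show ?thesis using split(1) snoc u(2) by auto
      qed
      have "p1 \<in> Q (step_end D x)"
        using split u(2,3) by (auto simp: Q_def)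
      from le[OF this] have 1: "\<pi> (step_end D x) \<le> cost p1" .
      have "walk D (step_end D x) (p2 @ [x]) (step_end D x)"
        using split(3) by (simp add: walk_append)
      then have "closed_steps D (p2 @ [x])" using walk_closed_iff[of "p2 @ [x]" D] by blast
      moreover have "distinct (map (step_end D) (p2 @ [x]))"
        using split(1) u(2) notin by auto
      ultimately have "0 \<le> cost (p2 @ [x])"
        unfolding cost_def using u(3) x split(1) by (intro cyc) auto
      with 1 show ?thesis using p(2) split(1) by (simp add: cost_def)
    qed
  qed
  with that show ?thesis by blast
qed

section \<open>Sink-stability as a potential\<close>

lemma sink_reverse_arcs_iff:
  "sink (reverse_arcs D F) v \<longleftrightarrow> v \<in> verts D \<and>
    (\<forall>e\<in>arcs D. (tail D e = v \<longrightarrow> e \<in> F) \<and> (head D e = v \<longrightarrow> e \<notin> F))"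
  by (auto simp: sink_def out_arcs_def reverse_arcs_def)

text \<open>
  From dicuts to a potential: an edge contributes 1 for the dicut containing it, if there is one, and nothing
  otherwise, as no edge leaves the set defining a dicut. From a potential to dicuts: an edge with
  increment 1 enters exactly one upper level set, namely the one at the value of its head, so these
  dicuts are disjoint.
\<close>

lemma sink_stable_iff_potential:
  fixes D :: "('a,'b) pre_digraph"
  assumes D: "fin_digraph D" and S: "S \<subseteq> verts D"
  shows "sink_stable D S \<longleftrightarrow> (\<exists>\<pi> :: 'a \<Rightarrow> int. \<forall>e\<in>arcs D.
    \<pi> (head D e) - \<pi> (tail D e) \<in> {0, 1} \<and>
    (tail D e \<in> S \<longrightarrow> \<pi> (head D e) - \<pi> (tail D e) = 1) \<and>
    (head D e \<in> S \<longrightarrow> \<pi> (head D e) - \<pi> (tail D e) = 0))" (is "_ \<longleftrightarrow> ?R")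
proof
  interpret fin_digraph D by fact
  assume "sink_stable D S"
  then obtain \<B> where dicuts: "\<And>B. B \<in> \<B> \<Longrightarrow> dicut D B" and disj: "pairwise disjnt \<B>"
    and sink: "sink_set (reverse_arcs D (\<Union>\<B>)) S"
    by (auto simp: sink_stable_def)
  have "\<forall>B\<in>\<B>. \<exists>Z. arcs_leaving D Z = {} \<and> B = arcs_entering D Z"
    using dicuts unfolding dicut_def by blast
  then obtain Z where Z: "\<And>B. B \<in> \<B> \<Longrightarrow> arcs_leaving D (Z B) = {} \<and> B = arcs_entering D (Z B)"
    unfolding bchoice_iff by blast
  have "\<B> \<subseteq> Pow (arcs D)" using Z by (auto simp: arcs_entering_def)
  then have fin: "finite \<B>" by (rule finite_subset) simp
  define \<pi> :: "'a \<Rightarrow> int" where "\<pi> v = (\<Sum>B\<in>\<B>. of_bool (v \<in> Z B))" for v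
  have diff: "\<pi> (head D e) - \<pi> (tail D e) = of_bool (e \<in> \<Union>\<B>)" if e: "e \<in> arcs D" for e
  proof -
    have "of_bool (head D e \<in> Z B) - of_bool (tail D e \<in> Z B) = (of_bool (e \<in> B) :: int)"
      if "B \<in> \<B>" for B
    proof -
      have "e \<in> B \<longleftrightarrow> tail D e \<notin> Z B \<and> head D e \<in> Z B"
        using Z[OF that] e unfolding arcs_entering_def by blast
      moreover have "tail D e \<in> Z B \<longrightarrow> head D e \<in> Z B"
        using Z[OF that] e unfolding arcs_leaving_def by blast
      ultimately show ?thesis by (auto simp: of_bool_def)
    qed
    then have "\<pi> (head D e) - \<pi> (tail D e) = (\<Sum>B\<in>\<B>. of_bool (e \<in> B))"
      by (simp add: \<pi>_def flip: sum_subtractf)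
    also have "\<dots> = of_bool (e \<in> \<Union>\<B>)"
    proof (cases "e \<in> \<Union>\<B>")
      case True
      then obtain B where B: "B \<in> \<B>" "e \<in> B" by blast
      have "e \<in> B' \<longleftrightarrow> B' = B" if "B' \<in> \<B>" for B'
        using disj B that unfolding pairwise_def disjnt_def by blast
      then have "(\<Sum>B'\<in>\<B>. of_bool (e \<in> B')) = (\<Sum>B'\<in>\<B>. of_bool (B' = B) :: int)"
        by (intro sum.cong) simp_all
      then show ?thesis using True B(1) fin by (simp add: of_bool_def)
    next
      case False
      then show ?thesis by (simp add: Union_iff)
    qed
    finally show ?thesis .
  qed
  have flips: "(tail D e \<in> S \<longrightarrow> e \<in> \<Union>\<B>) \<and> (head D e \<in> S \<longrightarrow> e \<notin> \<Union>\<B>)" if "e \<in> arcs D" for e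
    using sink that unfolding sink_set_def sink_reverse_arcs_iff by blast
  show ?R
  proof (rule exI[of _ \<pi>], intro ballI)
    fix e assume e: "e \<in> arcs D"
    show "\<pi> (head D e) - \<pi> (tail D e) \<in> {0, 1} \<and>
      (tail D e \<in> S \<longrightarrow> \<pi> (head D e) - \<pi> (tail D e) = 1) \<and>
      (head D e \<in> S \<longrightarrow> \<pi> (head D e) - \<pi> (tail D e) = 0)"
      unfolding diff[OF e] using flips[OF e] by (simp add: of_bool_def)
  qed
next
  interpret fin_digraph D by fact
  assume ?R
  then obtain \<pi> :: "'a \<Rightarrow> int"
    where bounds: "\<And>e. e \<in> arcs D \<Longrightarrow> \<pi> (head D e) - \<pi> (tail D e) \<in> {0, 1}"
    and out: "\<And>e. \<lbrakk>e \<in> arcs D; tail D e \<in> S\<rbrakk> \<Longrightarrow> \<pi> (head D e) - \<pi> (tail D e) = 1"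
    and into: "\<And>e. \<lbrakk>e \<in> arcs D; head D e \<in> S\<rbrakk> \<Longrightarrow> \<pi> (head D e) - \<pi> (tail D e) = 0"
    by blast
  define Z where "Z t = {v \<in> verts D. t \<le> \<pi> v}" for t
  have enter: "e \<in> arcs_entering D (Z t) \<longleftrightarrow>
    e \<in> arcs D \<and> \<pi> (head D e) - \<pi> (tail D e) = 1 \<and> t = \<pi> (head D e)" for e t
    using bounds[of e] by (auto simp: arcs_entering_def Z_def)
  have leave: "arcs_leaving D (Z t) = {}" for t
    using bounds by (fastforce simp: arcs_leaving_def Z_def)
  have un: "\<Union> (range (\<lambda>t. arcs_entering D (Z t))) = {e \<in> arcs D. \<pi> (head D e) - \<pi> (tail D e) = 1}"
    using enter by blast
  show "sink_stable D S"
    unfolding sink_stable_def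
  proof (intro exI[of _ "range (\<lambda>t. arcs_entering D (Z t))"] conjI ballI)
    fix B assume "B \<in> range (\<lambda>t. arcs_entering D (Z t))"
    then obtain t where "B = arcs_entering D (Z t)" by blast
    then show "dicut D B"
      unfolding dicut_def using leave by (intro exI[of _ "Z t"]) (auto simp: Z_def)
  next
    show "pairwise disjnt (range (\<lambda>t. arcs_entering D (Z t)))"
      by (rule pairwiseI) (auto simp: disjnt_iff enter)
  next
    show "sink_set (reverse_arcs D (\<Union> (range (\<lambda>t. arcs_entering D (Z t))))) S"
      unfolding sink_set_def sink_reverse_arcs_iff un using S out into by fastforce
  qed
qed

section \<open>The characterization\<close>

lemma card_directed_arcs:
  assumes "distinct (map fst w)"
  shows "card (forward_arcs w) = (\<Sum>x\<in>set w. of_bool (snd x))"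
    "card (backward_arcs w) = (\<Sum>x\<in>set w. of_bool (\<not> snd x))"
proof -
  have inj: "inj_on fst A" if "A \<subseteq> set w" for A
    using assms that by (metis distinct_map inj_on_subset)
  have f: "forward_arcs w = fst ` {x \<in> set w. snd x}" and b: "backward_arcs w = fst ` {x \<in> set w. \<not> snd x}"
    by (force simp: forward_arcs_def backward_arcs_def)+
  show "card (forward_arcs w) = (\<Sum>x\<in>set w. of_bool (snd x))"
    "card (backward_arcs w) = (\<Sum>x\<in>set w. of_bool (\<not> snd x))"
    unfolding f b by (simp_all add: card_image[OF inj] of_bool_def sum.If_cases Int_def)
qed

lemma card_Int_image:
  assumes "finite A" "inj_on f A"
  shows "card (S \<inter> f ` A) = (\<Sum>x\<in>A. of_bool (f x \<in> S))"
proof -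
  have "S \<inter> f ` A = f ` {x \<in> A. f x \<in> S}" by auto
  moreover have "inj_on f {x \<in> A. f x \<in> S}" using assms(2) by (rule inj_on_subset) auto
  ultimately show ?thesis
    using assms(1) by (simp add: card_image of_bool_def sum.If_cases Int_def)
qed

text \<open>
  Let \<open>d\<close> be the increment of the potential along a step. A forward step into \<open>S\<close> has \<open>d = 0\<close> and a
  backward step into \<open>S\<close> has \<open>d = -1\<close>; so \<open>[forward] - d\<close> is at least 1 on steps into \<open>S\<close>, and it is
  never negative. Symmetrically, \<open>[backward] + d\<close> is at least 1 on steps out of \<open>S\<close>. The terms \<open>d\<close>
  cancel when summed over a traversal.
\<close>

lemma sink_stable_card_le_eta:
  fixes D :: "('a,'b) pre_digraph"
  assumes D: "fin_digraph D" and S: "S \<subseteq> verts D" and st: "sink_stable D S" and C: "circuit D C"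
  shows "card (S \<inter> verts C) \<le> eta C"
proof -
  note c = circuitD[OF D C]
  obtain w where w: "traversal C w" using circuit_has_traversal[OF D C] by blast
  have dw: "distinct (map fst w)" and sw: "fst ` set w = arcs C"
    using w by (auto simp: traversal_iff)
  have ends: "inj_on (step_end D) (set w)" "step_end D ` set w = verts C"
    "inj_on (step_start D) (set w)" "step_start D ` set w = verts C"
    using traversal_visits_once[OF D C w] unfolding step_cong[OF c(4,5)] by (simp_all add: distinct_map)
  obtain \<pi> :: "'a \<Rightarrow> int" where \<pi>: "\<And>e. e \<in> arcs D \<Longrightarrow>
    \<pi> (head D e) - \<pi> (tail D e) \<in> {0, 1} \<and>
    (tail D e \<in> S \<longrightarrow> \<pi> (head D e) - \<pi> (tail D e) = 1) \<and>
    (head D e \<in> S \<longrightarrow> \<pi> (head D e) - \<pi> (tail D e) = 0)"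
    using st sink_stable_iff_potential[OF D S] by blast
  define d where "d x = \<pi> (step_end D x) - \<pi> (step_start D x)" for x
  have "(\<Sum>x\<in>set w. \<pi> (step_end D x)) = (\<Sum>x\<in>set w. \<pi> (step_start D x))"
    using sum.reindex[OF ends(1), of \<pi>] sum.reindex[OF ends(3), of \<pi>] ends(2,4) by simp
  then have d0: "(\<Sum>x\<in>set w. d x) = 0" by (simp add: d_def sum_subtractf)
  have step: "of_bool (step_end D x \<in> S) \<le> of_bool (snd x) - d x"
    "of_bool (step_start D x \<in> S) \<le> of_bool (\<not> snd x) + d x" if "x \<in> set w" for x
  proof -
    obtain e b where x: "x = (e, b)" by (cases x)
    have "e \<in> arcs D" using that x sw c(3) by force
    from \<pi>[OF this] show "of_bool (step_end D x \<in> S) \<le> of_bool (snd x) - d x"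
      "of_bool (step_start D x \<in> S) \<le> of_bool (\<not> snd x) + d x"
      unfolding x d_def by (cases b; auto simp: of_bool_def)+
  qed
  have "int (card (S \<inter> verts C)) = (\<Sum>x\<in>set w. of_bool (step_end D x \<in> S))"
    using card_Int_image[OF _ ends(1), of S] ends(2) by (simp add: of_nat_sum)
  also have "\<dots> \<le> (\<Sum>x\<in>set w. of_bool (snd x) - d x)" by (intro sum_mono step)
  also have "\<dots> = int (card (forward_arcs w))"
    unfolding card_directed_arcs[OF dw] by (simp add: sum_subtractf d0)
  finally have f: "card (S \<inter> verts C) \<le> card (forward_arcs w)" by simp
  have "int (card (S \<inter> verts C)) = (\<Sum>x\<in>set w. of_bool (step_start D x \<in> S))"
    using card_Int_image[OF _ ends(3), of S] ends(4) by (simp add: of_nat_sum)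
  also have "\<dots> \<le> (\<Sum>x\<in>set w. of_bool (\<not> snd x) + d x)" by (intro sum_mono step)
  also have "\<dots> = int (card (backward_arcs w))"
    unfolding card_directed_arcs[OF dw] by (simp add: sum.distrib d0)
  finally have "card (S \<inter> verts C) \<le> card (backward_arcs w)" by simp
  with f show ?thesis unfolding eta_eq[OF D C w] by simp
qed

text \<open>
  Both bounds on the increment are upper bounds on the change of \<open>\<pi>\<close> along a step, forward or
  backward, and in both cases the correction concerns the node where the step ends. Hence the total
  correction over a simple closed walk is the number of its nodes in \<open>S\<close>.
\<close>

lemma colouring_potential:
  fixes D :: "('a,'b) pre_digraph" and k :: nat
  assumes D: "fin_digraph D" and k: "k \<ge> 2"
    and circ: "\<And>C. circuit D C \<Longrightarrow> card (S \<inter> verts C) \<le> k * eta C"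
  obtains \<pi> :: "'a \<Rightarrow> int" where "\<And>e. e \<in> arcs D \<Longrightarrow>
    of_bool (tail D e \<in> S) \<le> \<pi> (head D e) - \<pi> (tail D e) \<and>
    \<pi> (head D e) - \<pi> (tail D e) \<le> int k - of_bool (head D e \<in> S)"
proof -
  interpret fin_digraph D by fact
  define c where "c x = int k * of_bool (snd x) - of_bool (step_end D x \<in> S)" for x :: "'b \<times> bool"
  have "0 \<le> sum_list (map c p)"
    if p: "closed_steps D p" "p \<noteq> []" "distinct (map (step_end D) p)" "set p \<subseteq> arcs D \<times> UNIV" for p
  proof (cases "distinct (map fst p)")
    case True
    let ?C = "walk_graph D p"
    have arcs: "fst ` set p \<subseteq> arcs D" using p(4) by auto
    have C: "circuit D ?C" and tr: "traversal ?C p"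
      using circuit_walk_graph[OF wf_digraph_axioms p(1,2) True arcs p(3)] by blast+
    have dp: "distinct p" "inj_on (step_end D) (set p)" using p(3) by (simp_all add: distinct_map)
    have "card (S \<inter> verts ?C) \<le> k * card (forward_arcs p)"
      using circ[OF C] unfolding eta_eq[OF D C tr]
      by (meson le_trans min.cobounded1 mult_le_mono2)
    then have "int (card (S \<inter> step_end D ` set p)) \<le> int k * int (card (forward_arcs p))"
      by (simp add: walk_graph_def flip: of_nat_mult)
    moreover have "sum_list (map c p) = int k * int (card (forward_arcs p)) - int (card (S \<inter> step_end D ` set p))"
      unfolding card_directed_arcs[OF True] card_Int_image[OF finite_set dp(2)]
        sum_list_distinct_conv_sum_set[OF dp(1)] c_def
      by (simp add: sum_subtractf sum_distrib_left)
    ultimately show ?thesis by simp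
  next
    case False
    then obtain x where x: "p = [x, flip x]"
      using simple_closed_walk_repeats_arc[OF p(1,3)] by blast
    \<comment> \<open>The cost is \<open>k\<close> minus the number of ends of this edge that lie in \<open>S\<close>.\<close>
    show ?thesis using k by (auto simp: x c_def flip_def of_bool_def)
  qed
  then obtain \<pi> :: "'a \<Rightarrow> int"
    where \<pi>: "\<And>x. x \<in> arcs D \<times> UNIV \<Longrightarrow> \<pi> (step_end D x) \<le> \<pi> (step_start D x) + c x"
    using potential_exists[of "arcs D \<times> UNIV" D c] by (metis finite_arcs finite_SigmaI finite)
  show ?thesis
  proof (rule that[of \<pi>])
    fix e assume "e \<in> arcs D"
    then show "of_bool (tail D e \<in> S) \<le> \<pi> (head D e) - \<pi> (tail D e) \<and>
      \<pi> (head D e) - \<pi> (tail D e) \<le> int k - of_bool (head D e \<in> S)"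
      using \<pi>[of "(e, True)"] \<pi>[of "(e, False)"] by (simp add: c_def)
  qed
qed

text \<open>
  Rounding down \<open>\<pi> div k\<close> turns increments between 0 and \<open>k\<close> into 0 or 1. Residue \<open>k - 1\<close> is the
  last one before a jump: starting from it any positive increment up to \<open>k\<close> crosses the jump, and
  arriving at it by an increment below \<open>k\<close> crosses none.
\<close>

lemma div_diff_bounds:
  fixes a b k :: int
  assumes "k > 0" "a \<le> b" "b \<le> a + k"
  shows "b div k - a div k \<in> {0, 1}"
proof -
  have "a div k \<le> b div k" using assms by (intro zdiv_mono1)
  moreover have "b div k \<le> (a + k) div k" using assms by (intro zdiv_mono1)
  ultimately show ?thesis using assms(1) by auto
qed

lemma div_diff_eq_one:
  fixes a b k :: int
  assumes "k > 0" "a mod k = k - 1" "a < b" "b \<le> a + k"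
  shows "b div k - a div k = 1"
proof -
  have "a + 1 = k * (a div k) + k" using mult_div_mod_eq[of k a] assms(2) by linarith
  then have "a div k + 1 = (a + 1) div k" using assms(1) by (simp only:) simp
  also have "\<dots> \<le> b div k" using assms by (intro zdiv_mono1) auto
  finally show ?thesis using div_diff_bounds[of k a b] assms by auto
qed

lemma div_diff_eq_zero:
  fixes a b k :: int
  assumes "k > 0" "b mod k = k - 1" "a \<le> b" "b < a + k"
  shows "b div k - a div k = 0"
  using div_diff_bounds[of k a b] div_diff_eq_one[of k b "a + k"] assms by auto

theorem theorem3p3:
  fixes D :: "('a,'b) pre_digraph" and k :: nat and S :: "'a set"
  assumes "fin_digraph D"
    and "k \<ge> 2"
    and "S \<subseteq> verts D"
  shows "k_sink_stable D k S \<longleftrightarrow>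
    (\<forall>C. circuit D C \<longrightarrow> card (S \<inter> verts C) \<le> k * eta C)"
proof (intro iffI allI impI)
  fix C assume "k_sink_stable D k S" and C: "circuit D C"
  then obtain P where S: "(\<Union>i<k. P i) = S"
    and st: "\<And>i. i < k \<Longrightarrow> sink_stable D (P i)"
    by (auto simp: k_sink_stable_def)
  have "card (S \<inter> verts C) = card (\<Union>i<k. P i \<inter> verts C)" unfolding S[symmetric] by (simp add: Int_UN_distrib2)
  also have "\<dots> \<le> (\<Sum>i<k. card (P i \<inter> verts C))" by (rule card_UN_le) simp
  also have "\<dots> \<le> (\<Sum>i<k. eta C)"
    using S assms(3) by (intro sum_mono sink_stable_card_le_eta[OF assms(1) _ st C]) auto
  finally show "card (S \<inter> verts C) \<le> k * eta C" by simp
next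
  assume circ: "\<forall>C. circuit D C \<longrightarrow> card (S \<inter> verts C) \<le> k * eta C"
  obtain \<pi> :: "'a \<Rightarrow> int" where \<pi>: "\<And>e. e \<in> arcs D \<Longrightarrow>
    of_bool (tail D e \<in> S) \<le> \<pi> (head D e) - \<pi> (tail D e) \<and>
    \<pi> (head D e) - \<pi> (tail D e) \<le> int k - of_bool (head D e \<in> S)"
    using colouring_potential[OF assms(1,2)] circ by metis
  have k: "int k > 0" using assms(2) by simp
  define P where "P i = {v \<in> S. \<pi> v mod int k = int i}" for i
  have "sink_stable D (P i)" if i: "i < k" for i
  proof -
    \<comment> \<open>The shift moves the residue \<open>i\<close> of the nodes in \<open>P i\<close> to \<open>k - 1\<close>, just before a jump.\<close>
    define \<rho> where "\<rho> v = \<pi> v + (int k - 1 - int i)" for v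
    have top: "\<rho> v mod int k = int k - 1" if "v \<in> P i" for v
    proof -
      have "\<rho> v mod int k = (\<pi> v mod int k + (int k - 1 - int i)) mod int k"
        by (simp only: \<rho>_def mod_add_left_eq)
      also have "\<pi> v mod int k + (int k - 1 - int i) = int k - 1"
        using that by (simp add: P_def)
      also have "(int k - 1) mod int k = int k - 1"
        using k by (intro mod_pos_pos_trivial) simp_all
      finally show ?thesis .
    qed
    have "\<rho> (head D e) div int k - \<rho> (tail D e) div int k \<in> {0, 1} \<and>
      (tail D e \<in> P i \<longrightarrow> \<rho> (head D e) div int k - \<rho> (tail D e) div int k = 1) \<and>
      (head D e \<in> P i \<longrightarrow> \<rho> (head D e) div int k - \<rho> (tail D e) div int k = 0)"
      if e: "e \<in> arcs D" for e
    proof (intro conjI impI)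
      have b: "\<rho> (tail D e) + of_bool (tail D e \<in> S) \<le> \<rho> (head D e)"
        "\<rho> (head D e) \<le> \<rho> (tail D e) + int k - of_bool (head D e \<in> S)"
        using \<pi>[OF e] by (auto simp: \<rho>_def)
      then have b': "\<rho> (tail D e) \<le> \<rho> (head D e)" "\<rho> (head D e) \<le> \<rho> (tail D e) + int k"
        by (auto simp: of_bool_def split: if_splits)
      show "\<rho> (head D e) div int k - \<rho> (tail D e) div int k \<in> {0, 1}"
        using div_diff_bounds[OF k b'] .
      show "\<rho> (head D e) div int k - \<rho> (tail D e) div int k = 1" if "tail D e \<in> P i"
        using that b b' by (intro div_diff_eq_one[OF k top]) (auto simp: P_def)
      show "\<rho> (head D e) div int k - \<rho> (tail D e) div int k = 0" if "head D e \<in> P i"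
        using that b b' by (intro div_diff_eq_zero[OF k top]) (auto simp: P_def)
    qed
    moreover have "P i \<subseteq> verts D" using assms(3) by (auto simp: P_def)
    ultimately show ?thesis
      using sink_stable_iff_potential[OF assms(1), of "P i"]
      by (auto intro!: exI[of _ "\<lambda>v. \<rho> v div int k"])
  qed
  moreover have "disjoint_family_on P {..<k}" by (auto simp: disjoint_family_on_def P_def)
  moreover have "(\<Union>i<k. P i) = S"
  proof
    show "S \<subseteq> (\<Union>i<k. P i)"
    proof
      fix v assume "v \<in> S"
      then have "v \<in> P (nat (\<pi> v mod int k))" using k by (simp add: P_def)
      moreover have "nat (\<pi> v mod int k) < k" using k by (simp add: nat_less_iff)
      ultimately show "v \<in> (\<Union>i<k. P i)" by blast
    qed
  qed (auto simp: P_def)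
  ultimately show "k_sink_stable D k S" unfolding k_sink_stable_def by blast
qed

end
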